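(* Let $u_\lambda$ be a singular vector of $J$ with singular value $\lambda\neq 0$ and dual singular vector $p_\lambda=\lambda K^*Ku_\lambda\in\partial J(u_\lambda)$. Let $\alpha>0$, let $f=K\tilde u+\eta$ with $\tilde u\in\mathcal U$ and $\eta\in\mathcal H$, and let $$\hat u\in\arg\min_{u\in\mathrm{dom}(J)}\left\{\tfrac12\|Ku-f\|_{\mathcal H}^2+\alpha J(u)\right\}.$$ Then, with $\hat p\in\partial J(\hat u)$ denoting the subgradient in the optimality condition $K^*(K\hat u-f)+\alpha\hat p=0$, the estimate $$\left|\left\langle \tfrac1\lambda p_\lambda,\hat u-\tilde u\right\rangle_{\mathcal U}\right|\le\left|\langle\eta,Ku_\lambda\rangle_{\mathcal H}\right|+\alpha\left|\langle\hat p,u_\lambda\rangle_{\mathcal U}\right|$$ holds.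
   Context: Setting: $\mathcal U$ is a real Banach space that is the dual of some Banach space, $\mathcal H$ is a real Hilbert space, $K:\mathcal U\to\mathcal H$ is a bounded linear operator, and $J:\mathcal U\to\mathbb{R}\cup\{+\infty\}$ is proper, convex and non-negative, with $\mathrm{dom}(J)=\{u: J(u)<\infty\}$ and with non-empty subdifferential at every $u\in\mathrm{dom}(J)$. $\langle\cdot,\cdot\rangle_{\mathcal U}$ is the dual pairing between $\mathcal U^*$ and $\mathcal U$, and $K^*:\mathcal H\to\mathcal U^*$ is the adjoint, $\langle K^*h,u\rangle_{\mathcal U}=\langle h,Ku\rangle_{\mathcal H}$. The subdifferential is $\partial J(u)=\{p\in\mathcal U^* : J(v)-J(u)-\langle p,v-u\rangle_{\mathcal U}\ge 0\ \forall v\in\mathcal U\}$. A singular vector of $J$ with singular value $\lambda$ is an element $u_\lambda\ne0$ with $\|Ku_\lambda\|_{\mathcal H}=1$ and $\lambda K^*Ku_\lambda\in\partial J(u_\lambda)$; $p_\lambda=\lambda K^*Ku_\lambda$ is its dual singular vector. *)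

theory Defs
  imports "HOL-Analysis.Analysis"
begin

definition isometric_isomorphism :: "('a::real_normed_vector \<Rightarrow> 'b::real_normed_vector) \<Rightarrow> bool" where
  "isometric_isomorphism \<Phi> \<longleftrightarrow> linear \<Phi> \<and> bij \<Phi> \<and> (\<forall>u. norm (\<Phi> u) = norm u)"

definition effective_domain :: "('u \<Rightarrow> ereal) \<Rightarrow> 'u set" where
  "effective_domain J = {u. J u < \<infinity>}"

definition proper_functional :: "('u \<Rightarrow> ereal) \<Rightarrow> bool" where
  "proper_functional J \<longleftrightarrow> effective_domain J \<noteq> {} \<and> (\<forall>u. J u \<noteq> - \<infinity>)"

(* The library's convex_on is for real-valued functions only. At t = 0 and t = 1 the
   ereal convention 0 * \<infinity> = 0 makes the inequality trivial. *)
definition convex_functional :: "('u::real_vector \<Rightarrow> ereal) \<Rightarrow> bool" where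
  "convex_functional J \<longleftrightarrow>
     (\<forall>u v t. 0 \<le> t \<and> t \<le> 1 \<longrightarrow>
        J ((1 - t) *\<^sub>R u + t *\<^sub>R v) \<le> ereal (1 - t) * J u + ereal t * J v)"

(* In ereal, \<infinity> - \<infinity> = \<infinity>; for proper J the set below is nevertheless empty when J u = \<infinity>,
   because some v has J v - J u = - \<infinity>. *)
definition subdifferential ::
    "('u::real_normed_vector \<Rightarrow> ereal) \<Rightarrow> 'u \<Rightarrow> ('u \<Rightarrow>\<^sub>L real) set" where
  "subdifferential J u =
     {p. \<forall>v. J v - J u - ereal (blinfun_apply p (v - u)) \<ge> 0}"

lemma subdifferential_outside_domain:
  assumes "proper_functional J" "u \<notin> effective_domain J"
  shows "subdifferential J u = {}"
proof -
  have "J u = \<infinity>" using assms(2) by (simp add: effective_domain_def)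
  moreover obtain v where "J v < \<infinity>"
    using assms(1) by (auto simp: proper_functional_def effective_domain_def)
  ultimately have "\<not> J v - J u - ereal (blinfun_apply p (v - u)) \<ge> 0" for p
    by (cases "J v") auto
  then show ?thesis unfolding subdifferential_def by blast
qed

(* The library's adjoint acts between inner product spaces; here the domain of K is only
   normed and the adjoint takes values in its dual. *)
definition dual_adjoint ::
    "('u::real_normed_vector \<Rightarrow>\<^sub>L 'h::real_inner) \<Rightarrow> 'h \<Rightarrow> ('u \<Rightarrow>\<^sub>L real)" where
  "dual_adjoint K h = blinfun_inner_right h o\<^sub>L K"

lemma dual_adjoint_apply:
  "blinfun_apply (dual_adjoint K h) u = inner h (blinfun_apply K u)"
  by (simp add: dual_adjoint_def)

definition dual_singular_vector ::
    "('u::real_normed_vector \<Rightarrow>\<^sub>L 'h::real_inner) \<Rightarrow> real \<Rightarrow> 'u \<Rightarrow> ('u \<Rightarrow>\<^sub>L real)" where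
  "dual_singular_vector K lam u = lam *\<^sub>R dual_adjoint K (blinfun_apply K u)"

definition singular_vector ::
    "('u::real_normed_vector \<Rightarrow>\<^sub>L 'h::real_inner) \<Rightarrow> ('u \<Rightarrow> ereal) \<Rightarrow> real \<Rightarrow> 'u \<Rightarrow> bool" where
  "singular_vector K J lam u \<longleftrightarrow>
     u \<noteq> 0 \<and> norm (blinfun_apply K u) = 1 \<and> dual_singular_vector K lam u \<in> subdifferential J u"

end

theory Submission
  imports Defs
begin

text \<open>Comparing \<open>u\<close> with \<open>u + t (v - u)\<close> and letting \<open>t\<close> tend to 0 shows that the
  negative scaled gradient of the data term at a minimiser \<open>u\<close> is a subgradient of \<open>J\<close>, so the
  optimality condition has exactly one solution. Testing that condition with the singular
  vector turns the residual \<open>K u - f\<close> into the subgradient term, and the rest of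
  \<open>K (u - u_true)\<close> is the noise.\<close>

text \<open>Division by \<open>t\<close> leaves \<open>a + t * b\<close>, which tends to
  \<open>a\<close> as \<open>t\<close> decreases to 0.\<close>

lemma nonneg_if_quadratic_nonneg_near_0:
  fixes a b :: real
  assumes "\<And>t. 0 < t \<Longrightarrow> t \<le> 1 \<Longrightarrow> 0 \<le> t * a + t\<^sup>2 * b"
  shows "0 \<le> a"
proof (rule tendsto_lowerbound)
  show "((\<lambda>t. a + t * b) \<longlongrightarrow> a) (at_right 0)"
    by (auto intro!: tendsto_eq_intros)
  have "0 \<le> a + t * b" if "0 < t" "t < 1" for t
  proof -
    have "0 \<le> t * (a + t * b)"
      using assms[of t] that by (simp add: algebra_simps power2_eq_square)
    then show ?thesis
      using that by (simp add: zero_le_mult_iff)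
  qed
  then show "\<forall>\<^sub>F t in at_right 0. 0 \<le> a + t * b"
    using eventually_at_right_real[of 0 1] by (auto elim!: eventually_mono)
qed simp

lemma effective_domain_real:
  assumes "proper_functional J" "u \<in> effective_domain J"
  obtains r where "J u = ereal r"
  using assms by (cases "J u") (auto simp: proper_functional_def effective_domain_def)

text \<open>Along the segment from \<open>u\<close> to \<open>v\<close> the data term is an exact
  quadratic in \<open>t\<close>, and convexity bounds \<open>J\<close> by its chord. Minimality then
  forces the coefficient of first order in \<open>t\<close>, the expression below, to be
  non-negative.\<close>

lemma arg_min_variational_inequality:
  fixes K :: "'u::real_normed_vector \<Rightarrow>\<^sub>L 'h::real_inner"
  assumes proper: "proper_functional J" and convex: "convex_functional J"
    and "\<alpha> > 0"
    and min: "is_arg_min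
           (\<lambda>u. ereal (1 / 2 * (norm (K u - f))\<^sup>2) + ereal \<alpha> * J u)
           (\<lambda>u. u \<in> effective_domain J) u"
    and Ju: "J u = ereal a" and Jv: "J v = ereal b"
  shows "0 \<le> inner (K u - f) (K (v - u)) + \<alpha> * (b - a)"
proof (rule nonneg_if_quadratic_nonneg_near_0)
  fix t :: real
  assume t: "0 < t" "t \<le> 1"
  define w where "w = (1 - t) *\<^sub>R u + t *\<^sub>R v"
  have "J w \<le> ereal (1 - t) * J u + ereal t * J v"
    using convex t by (simp add: convex_functional_def w_def)
  then have Jw_le: "J w \<le> ereal ((1 - t) * a + t * b)"
    by (simp add: Ju Jv)
  \<comment> \<open>Minimality compares \<open>u\<close> only with points of the domain; the finite
    chord value places \<open>w\<close> there.\<close>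
  then have dom: "w \<in> effective_domain J"
    by (auto simp: effective_domain_def)
  obtain c where c: "J w = ereal c"
    using effective_domain_real[OF proper dom] .
  have Kw: "K w - f = (K u - f) + t *\<^sub>R K (v - u)"
    by (simp add: w_def blinfun.add_right blinfun.diff_right blinfun.scaleR_right algebra_simps)
  have "1 / 2 * (norm (K u - f))\<^sup>2 + \<alpha> * a \<le> 1 / 2 * (norm (K w - f))\<^sup>2 + \<alpha> * c"
    using min dom Ju c by (auto simp: is_arg_min_def not_less)
  also have "\<dots> \<le> 1 / 2 * (norm (K w - f))\<^sup>2 + \<alpha> * ((1 - t) * a + t * b)"
    using Jw_le c \<open>\<alpha> > 0\<close> by simp
  \<comment> \<open>After this expansion the terms of order zero cancel against the value at
    \<open>u\<close>, leaving only the orders \<open>t\<close> and \<open>t\<^sup>2\<close>.\<close>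
  also have "(norm (K w - f))\<^sup>2 =
      (norm (K u - f))\<^sup>2 + 2 * t * inner (K u - f) (K (v - u)) + t\<^sup>2 * (norm (K (v - u)))\<^sup>2"
    unfolding Kw power2_norm_eq_inner
    by (simp add: inner_add_left inner_add_right inner_commute power2_eq_square algebra_simps)
  finally show "0 \<le> t * (inner (K u - f) (K (v - u)) + \<alpha> * (b - a))
      + t\<^sup>2 * (1 / 2 * (norm (K (v - u)))\<^sup>2)"
    by (simp add: algebra_simps)
qed

text \<open>The variational inequality divided by \<alpha> is the subgradient inequality at each
  \<open>v\<close> in the domain.\<close>

lemma arg_min_subgradient:
  fixes K :: "'u::real_normed_vector \<Rightarrow>\<^sub>L 'h::real_inner"
  assumes proper: "proper_functional J" and "convex_functional J"
    and "\<alpha> > 0"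
    and min: "is_arg_min
           (\<lambda>u. ereal (1 / 2 * (norm (K u - f))\<^sup>2) + ereal \<alpha> * J u)
           (\<lambda>u. u \<in> effective_domain J) u"
  shows "- (1 / \<alpha>) *\<^sub>R dual_adjoint K (K u - f) \<in> subdifferential J u" (is "?p \<in> _")
proof -
  have "u \<in> effective_domain J"
    using min by (simp add: is_arg_min_def)
  with proper obtain a where a: "J u = ereal a"
    by (rule effective_domain_real)
  have "0 \<le> J v - J u - ereal (?p (v - u))" for v
  proof (cases "v \<in> effective_domain J")
    case True
    with proper obtain b where b: "J v = ereal b"
      by (rule effective_domain_real)
    have "0 \<le> inner (K u - f) (K (v - u)) + \<alpha> * (b - a)"
      using arg_min_variational_inequality[OF assms a b] .
    then have "0 \<le> b - a + inner (K u - f) (K (v - u)) / \<alpha>"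
      using \<open>\<alpha> > 0\<close> by (simp add: field_simps)
    then show ?thesis
      by (simp add: a b blinfun.scaleR_left blinfun.minus_left dual_adjoint_apply)
  next
    \<comment> \<open>Here \<open>J v\<close> is \<infinity> while \<open>J u\<close> is finite, so
      the left-over difference is \<infinity>.\<close>
    case False
    then show ?thesis
      by (simp add: a effective_domain_def)
  qed
  then show ?thesis
    by (simp add: subdifferential_def)
qed

text \<open>The factor \<open>lam\<close> cancels, so the left side is the inner product of
  \<open>K w\<close> with \<open>K (u - u')\<close>, which is the residual plus \<eta>. The
  optimality condition evaluated at \<open>w\<close> replaces the residual part by
  \<open>- \<alpha> * p w\<close>.\<close>

lemma singular_vector_error_identity:
  fixes K :: "'u::real_normed_vector \<Rightarrow>\<^sub>L 'h::real_inner"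
  assumes "lam \<noteq> 0"
    and opt: "dual_adjoint K (K u - (K u' + \<eta>)) + \<alpha> *\<^sub>R p = 0"
  shows "((1 / lam) *\<^sub>R dual_singular_vector K lam w) (u - u') = inner \<eta> (K w) - \<alpha> * p w"
proof -
  have "(dual_adjoint K (K u - (K u' + \<eta>)) + \<alpha> *\<^sub>R p) w = 0"
    by (simp only: opt zero_blinfun.rep_eq)
  then have "inner (K u - (K u' + \<eta>)) (K w) + \<alpha> * p w = 0"
    by (simp add: blinfun.add_left blinfun.scaleR_left dual_adjoint_apply)
  then show ?thesis
    using \<open>lam \<noteq> 0\<close>
    by (simp add: dual_singular_vector_def dual_adjoint_apply blinfun.scaleR_left
        blinfun.diff_right inner_diff_left inner_add_left inner_diff_right inner_add_right
        inner_commute)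
qed

theorem theorem3:
  fixes \<Phi> :: "'u::banach \<Rightarrow> ('x::banach \<Rightarrow>\<^sub>L real)"
    and K :: "'u \<Rightarrow>\<^sub>L 'h::{real_inner,complete_space}"
    and J :: "'u \<Rightarrow> ereal"
    and u_sing u_true u_hat :: 'u
    and p_sing :: "'u \<Rightarrow>\<^sub>L real"
    and \<eta> f :: 'h
    and lam \<alpha> :: real
  assumes "isometric_isomorphism \<Phi>"
    and "proper_functional J"
    and "convex_functional J"
    and "\<forall>u. 0 \<le> J u"
    and "\<forall>u \<in> effective_domain J. subdifferential J u \<noteq> {}"
    and "singular_vector K J lam u_sing"
    and "lam \<noteq> 0"
    and "p_sing = dual_singular_vector K lam u_sing"
    and "\<alpha> > 0"
    and "f = blinfun_apply K u_true + \<eta>"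
    and "is_arg_min
           (\<lambda>u. ereal (1 / 2 * (norm (blinfun_apply K u - f))\<^sup>2) + ereal \<alpha> * J u)
           (\<lambda>u. u \<in> effective_domain J) u_hat"
  shows "(\<exists>!p_hat. p_hat \<in> subdifferential J u_hat \<and>
            dual_adjoint K (blinfun_apply K u_hat - f) + \<alpha> *\<^sub>R p_hat = 0) \<and>
         (\<forall>p_hat. p_hat \<in> subdifferential J u_hat \<and>
            dual_adjoint K (blinfun_apply K u_hat - f) + \<alpha> *\<^sub>R p_hat = 0 \<longrightarrow>
            \<bar>blinfun_apply ((1 / lam) *\<^sub>R p_sing) (u_hat - u_true)\<bar>
              \<le> \<bar>inner \<eta> (blinfun_apply K u_sing)\<bar> + \<alpha> * \<bar>blinfun_apply p_hat u_sing\<bar>)"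
proof (intro conjI allI impI)
  \<comment> \<open>The optimality condition solved for \<open>p_hat\<close>: the only possible
    candidate, since \<alpha> is nonzero.\<close>
  let ?p = "- (1 / \<alpha>) *\<^sub>R dual_adjoint K (K u_hat - f)"
  show "\<exists>!p_hat. p_hat \<in> subdifferential J u_hat \<and>
      dual_adjoint K (K u_hat - f) + \<alpha> *\<^sub>R p_hat = 0"
  proof (rule ex1I[of _ ?p])
    show "?p \<in> subdifferential J u_hat \<and> dual_adjoint K (K u_hat - f) + \<alpha> *\<^sub>R ?p = 0"
      using arg_min_subgradient[OF assms(2,3,9,11)] \<open>\<alpha> > 0\<close> by simp
  next
    fix p
    assume "p \<in> subdifferential J u_hat \<and> dual_adjoint K (K u_hat - f) + \<alpha> *\<^sub>R p = 0"
    then have "dual_adjoint K (K u_hat - f) = - (\<alpha> *\<^sub>R p)"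
      by (simp add: eq_neg_iff_add_eq_0)
    then show "p = ?p"
      using \<open>\<alpha> > 0\<close> by simp
  qed
next
  fix p
  assume "p \<in> subdifferential J u_hat \<and> dual_adjoint K (K u_hat - f) + \<alpha> *\<^sub>R p = 0"
  then have "((1 / lam) *\<^sub>R p_sing) (u_hat - u_true) = inner \<eta> (K u_sing) - \<alpha> * p u_sing"
    using singular_vector_error_identity[OF \<open>lam \<noteq> 0\<close>] assms(8,10) by blast
  \<comment> \<open>The error is known exactly up to here; the triangle inequality is the only
    loss.\<close>
  then show "\<bar>((1 / lam) *\<^sub>R p_sing) (u_hat - u_true)\<bar>
      \<le> \<bar>inner \<eta> (K u_sing)\<bar> + \<alpha> * \<bar>p u_sing\<bar>"
    using abs_triangle_ineq4[of "inner \<eta> (K u_sing)" "\<alpha> * p u_sing"] \<open>\<alpha> > 0\<close>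
    by (simp add: abs_mult)
qed

end
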